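(* Consider the full-order solution and the WST-LSPG solution over windows $0,\dots,N_w-1$, as defined in the context. Assume: (A1) there is $\kappa>0$ with $\|\boldsymbol f(\boldsymbol w,t)-\boldsymbol f(\boldsymbol y,t)\|_2\le\kappa\|\boldsymbol w-\boldsymbol y\|_2$ for all $\boldsymbol w,\boldsymbol y\in\mathbb R^{N_s}$, $t\in[0,T]$; (A2) $\sigma_{\min}(\boldsymbol A^k)-\sigma_{\max}(\boldsymbol B^k)\,\Delta t\,\kappa>0$ for every window $k\in\{0,\dots,N_w-1\}$. Set $a^k=\sigma_{\min}(\boldsymbol A^k)-\sigma_{\max}(\boldsymbol B^k)\Delta t\,\kappa$ and $b^k=\sigma_{\max}(\boldsymbol A_0^k)+\Delta t\,\kappa\,\sigma_{\max}(\boldsymbol B_0^k)$. For each window $i$ let $\mathbb P\boldsymbol u^i=\arg\min_{\boldsymbol w\in\mathcal S^i}\|\boldsymbol u^i-\boldsymbol w\|_2$ be the $\ell^2$-orthogonal projection of the full-order solution onto the trial space of window $i$, and let $\mathbb P\boldsymbol u_0^i$ be the $\ell^2$-orthogonal projection of the full-order starting state $\boldsymbol u_0^i$ onto the (affine) trial subspace $\mathcal T^i\subseteq\mathbb R^{N_s}$ for the starting state, which contains $\tilde{\boldsymbol u}_0^i$. Then for every $k\in\{0,\dots,N_w-1\}$ the error $\boldsymbol e^k=\tilde{\boldsymbol u}^k-\boldsymbol u^k$ of the WST-LSPG solution over the $k$-th window satisfies $$\|\boldsymbol e^k\|_2\le\sum_{i=0}^{k}\left(\frac{\prod_{j=0}^{k-i-1}2\,b^{k-j}}{\prod_{j=0}^{k-i}a^{k-j}}\right)\big\|\overline{\boldsymbol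 r}^i(\mathbb P\boldsymbol u^i;\mathbb P\boldsymbol u_0^i)\big\|_2,$$ where products include both limits and an empty product equals $1$.
   Context: All superscripts $k,i,k-j$ on $a,b,\boldsymbol e,\boldsymbol u,\tilde{\boldsymbol u},\overline{\boldsymbol r}$ and the matrices are window indices, not powers. $\sigma_{\min},\sigma_{\max}$ denote minimum and maximum singular values; $\|\cdot\|_2$ is the Euclidean norm. A parameter value is fixed and suppressed. Full-order model: an ODE $\dot{\boldsymbol u}=\boldsymbol f(\boldsymbol u,t)$ with $\boldsymbol f:\mathbb R^{N_s}\times[0,T]\to\mathbb R^{N_s}$ and initial state $\boldsymbol u^{\mathrm{init}}\in\mathbb R^{N_s}$ is discretized at times $t^0<t^1<\dots<t^{N_t}$ with constant step $\Delta t>0$ by a linear multistep method with stencil width $s_n$ at step $n$: coefficients $\alpha_j^n,\beta_j^n\in\mathbb R$, $0\le j\le s_n$, with $\alpha_0^n\ne0$ and $\sum_{j=0}^{s_n}\alpha_j^n=0$, and residual $$\boldsymbol r^n(\boldsymbol w^n;\boldsymbol w^{n-1},\dots,\boldsymbol w^{n-s_n})=\sum_{j=0}^{s_n}\alpha_j^n\boldsymbol w^{n-j}-\Delta t\sum_{j=0}^{s_n}\beta_j^n\boldsymbol f(\boldsymbol w^{n-j},t^{n-j}).$$ Windows: the steps $1,\dots,N_t$ are partitioned into $N_w$ consecutive windows; window $k\in\{0,\dots,N_w-1\}$ contains $N_t^k$ steps, namely $\theta(k),\dots,\theta(k)+N_t^k-1$, with $\theta(k)=1+\sum_{j=0}^{k-1}N_t^j$.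 The stencil width at the first step of each window is one ($s_{\theta(k)}=1$), and no stencil inside a window reaches back before the state at step $\theta(k)-1$ (i.e. $s_{\theta(k)+\ell-1}\le\ell$ for $1\le\ell\le N_t^k$). Windowed residual: for $\boldsymbol w=[(\boldsymbol w^1)^T\cdots(\boldsymbol w^{N_t^k})^T]^T\in\mathbb R^{N_sN_t^k}$ and starting state $\boldsymbol w_0\in\mathbb R^{N_s}$, $\overline{\boldsymbol r}^k(\boldsymbol w;\boldsymbol w_0)\in\mathbb R^{N_sN_t^k}$ stacks the residuals of all steps of window $k$ (with $\boldsymbol w^\ell$ the state at step $\theta(k)+\ell-1$ and $\boldsymbol w_0$ the state at step $\theta(k)-1$). Equivalently $$\overline{\boldsymbol r}^k(\boldsymbol w;\boldsymbol w_0)=\boldsymbol A^k\boldsymbol w-\Delta t\,\boldsymbol B^k\,\overline{\boldsymbol f}^k(\boldsymbol w)+\boldsymbol A_0^k\boldsymbol w_0-\Delta t\,\boldsymbol B_0^k\boldsymbol f(\boldsymbol w_0,t^{\theta(k)-1}),$$ where $\overline{\boldsymbol f}^k(\boldsymbol w)$ stacks $\boldsymbol f(\boldsymbol w^\ell,t^{\theta(k)+\ell-1})$, $\ell=1,\dots,N_t^k$; $\boldsymbol A^k\in\mathbb R^{N_sN_t^k\times N_sN_t^k}$ has $N_s\times N_s$ block $(\ell,\ell-j)$ equal to $\alpha_j^{\theta(k)+\ell-1}\boldsymbol I$ for $0\le j\le s_{\theta(k)+\ell-1}$, $\ell-j\ge1$, other blocks zero; $\boldsymbol A_0^k\in\mathbb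 R^{N_sN_t^k\times N_s}$ has $\ell$-th block $\alpha_\ell^{\theta(k)+\ell-1}\boldsymbol I$ if $s_{\theta(k)+\ell-1}=\ell$ and zero otherwise; $\boldsymbol B^k,\boldsymbol B_0^k$ are defined identically with $\beta$ in place of $\alpha$. Full-order solution: $\boldsymbol u^k\in\mathbb R^{N_sN_t^k}$ with starting state $\boldsymbol u_0^k$ satisfies $\overline{\boldsymbol r}^k(\boldsymbol u^k;\boldsymbol u_0^k)=\boldsymbol 0$, where $\boldsymbol u_0^0=\boldsymbol u^{\mathrm{init}}$ and, for $k\ge1$, $\boldsymbol u_0^k$ is the last $N_s$-block of $\boldsymbol u^{k-1}$. WST-LSPG solution (windowed space--time least-squares Petrov--Galerkin, no hyper-reduction): computed sequentially for $k=0,\dots,N_w-1$. The starting state is $\tilde{\boldsymbol u}_0^0=\boldsymbol u^{\mathrm{init}}$ and, for $k\ge1$, $\tilde{\boldsymbol u}_0^k$ is the last $N_s$-block of $\tilde{\boldsymbol u}^{k-1}$. Given a basis matrix $\boldsymbol\Pi^k\in\mathbb R^{N_sN_t^k\times n^k}$, the affine trial subspace is $\mathcal S^k=\{\boldsymbol u_{\mathrm{ref}}^k+\boldsymbol\Pi^k\boldsymbol z:\boldsymbol z\in\mathbb R^{n^k}\}$, where $\boldsymbol u_{\mathrm{ref}}^k$ stacks $N_t^k$ copies of $\tilde{\boldsymbol u}_0^k$, and $\tilde{\boldsymbol u}^k\in\mathcal S^k$ is a minimizer of $\boldsymbol w\mapsto\|\overline{\boldsymbol r}^k(\boldsymbol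 w;\tilde{\boldsymbol u}_0^k)\|_2^2$ over $\mathcal S^k$. Trial subspace for starting states: $\mathcal T^k\subseteq\mathbb R^{N_s}$ is an affine subspace in which the reduced model's starting state lives; the only property used is that it is an affine subspace with $\tilde{\boldsymbol u}_0^k\in\mathcal T^k$. *)

theory Defs
  imports Complex_Main "Jordan_Normal_Form.Char_Poly"
begin

text \<open>
  The lengths of the windows vary, so vectors and matrices are those of
  \<^theory>\<open>Jordan_Normal_Form.Matrix\<close>, whose dimensions are terms. The synonyms avoid the clash with
  the type constructor \<open>vec\<close> of HOL-Analysis in theories that import both.
\<close>

type_synonym rvec = "real vec"
type_synonym rmat = "real mat"

definition vnorm :: "rvec \<Rightarrow> real" where
  "vnorm v = sqrt (v \<bullet> v)"

text \<open>
  An \<open>m \<times> n\<close> matrix has \<open>min m n\<close> singular values, so the smaller of the two Gram matrices is used;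
  the larger one may have additional zero eigenvalues.
\<close>

definition singular_values :: "rmat \<Rightarrow> real set" where
  "singular_values M =
     {sqrt e | e. eigenvalue (if dim_col M \<le> dim_row M then transpose_mat M * M
                              else M * transpose_mat M) e}"

definition sigma_min :: "rmat \<Rightarrow> real" where
  "sigma_min M = Min (singular_values M)"

definition sigma_max :: "rmat \<Rightarrow> real" where
  "sigma_max M = Max (singular_values M)"

text \<open>The condition of \<open>affine\<close> in HOL-Analysis, which is only available for type-class vectors.\<close>

definition affine_subspace :: "nat \<Rightarrow> rvec set \<Rightarrow> bool" where
  "affine_subspace d S \<longleftrightarrow>
     S \<noteq> {} \<and> S \<subseteq> carrier_vec d \<and>
     (\<forall>x\<in>S. \<forall>y\<in>S. \<forall>u v. u + v = 1 \<longrightarrow> u \<cdot>\<^sub>v x + v \<cdot>\<^sub>v y \<in> S)"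

text \<open>Blocks are numbered from 1, entries within a block from 0.\<close>

definition vec_block :: "nat \<Rightarrow> rvec \<Rightarrow> nat \<Rightarrow> rvec" where
  "vec_block Ns w l = vec Ns (\<lambda>i. w $ ((l - 1) * Ns + i))"

definition stack :: "nat \<Rightarrow> nat \<Rightarrow> (nat \<Rightarrow> rvec) \<Rightarrow> rvec" where
  "stack Ns m g = vec (Ns * m) (\<lambda>p. g (p div Ns + 1) $ (p mod Ns))"

text \<open>
  \<open>Nt k\<close> is the number of steps of window \<open>k\<close>, \<open>s n\<close> the stencil width at step \<open>n\<close>, and
  \<open>\<alpha> n j\<close>, \<open>\<beta> n j\<close> are the multistep coefficients at step \<open>n\<close>.
\<close>

definition theta :: "(nat \<Rightarrow> nat) \<Rightarrow> nat \<Rightarrow> nat" where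
  "theta Nt k = 1 + (\<Sum>j<k. Nt j)"

text \<open>In the residual of step \<open>n\<close>, \<open>W m\<close> is the state at step \<open>m\<close>.\<close>

definition lmm_residual ::
  "nat \<Rightarrow> (rvec \<Rightarrow> real \<Rightarrow> rvec) \<Rightarrow> real \<Rightarrow> (nat \<Rightarrow> real) \<Rightarrow> (nat \<Rightarrow> nat) \<Rightarrow>
   (nat \<Rightarrow> nat \<Rightarrow> real) \<Rightarrow> (nat \<Rightarrow> nat \<Rightarrow> real) \<Rightarrow> nat \<Rightarrow> (nat \<Rightarrow> rvec) \<Rightarrow> rvec" where
  "lmm_residual Ns f dt t s \<alpha> \<beta> n W =
     vec Ns (\<lambda>i. (\<Sum>j\<le>s n. \<alpha> n j * W (n - j) $ i)
                 - dt * (\<Sum>j\<le>s n. \<beta> n j * f (W (n - j)) (t (n - j)) $ i))"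

definition window_state :: "nat \<Rightarrow> (nat \<Rightarrow> nat) \<Rightarrow> nat \<Rightarrow> rvec \<Rightarrow> rvec \<Rightarrow> nat \<Rightarrow> rvec" where
  "window_state Ns Nt k w w0 m =
     (if m = theta Nt k - 1 then w0 else vec_block Ns w (m + 1 - theta Nt k))"

definition window_residual ::
  "nat \<Rightarrow> (rvec \<Rightarrow> real \<Rightarrow> rvec) \<Rightarrow> real \<Rightarrow> (nat \<Rightarrow> real) \<Rightarrow> (nat \<Rightarrow> nat) \<Rightarrow> (nat \<Rightarrow> nat) \<Rightarrow>
   (nat \<Rightarrow> nat \<Rightarrow> real) \<Rightarrow> (nat \<Rightarrow> nat \<Rightarrow> real) \<Rightarrow> nat \<Rightarrow> rvec \<Rightarrow> rvec \<Rightarrow> rvec" where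
  "window_residual Ns f dt t Nt s \<alpha> \<beta> k w w0 =
     stack Ns (Nt k) (\<lambda>l. lmm_residual Ns f dt t s \<alpha> \<beta> (theta Nt k + l - 1) (window_state Ns Nt k w w0))"

text \<open>
  With \<open>c = \<alpha>\<close> the next two are the matrices \<open>A\<^sup>k\<close> and \<open>A\<^sub>0\<^sup>k\<close>, with \<open>c = \<beta>\<close> they are
  \<open>B\<^sup>k\<close> and \<open>B\<^sub>0\<^sup>k\<close>. Entry \<open>(p, q)\<close> lies in block row \<open>l\<close> and block column \<open>l'\<close>.
\<close>

definition lmm_mat ::
  "nat \<Rightarrow> (nat \<Rightarrow> nat) \<Rightarrow> (nat \<Rightarrow> nat) \<Rightarrow> (nat \<Rightarrow> nat \<Rightarrow> real) \<Rightarrow> nat \<Rightarrow> rmat" where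
  "lmm_mat Ns Nt s c k =
     mat (Ns * Nt k) (Ns * Nt k) (\<lambda>(p, q).
       let l = p div Ns + 1; l' = q div Ns + 1; n = theta Nt k + l - 1 in
       if p mod Ns = q mod Ns \<and> l' \<le> l \<and> l - l' \<le> s n then c n (l - l') else 0)"

definition lmm_mat0 ::
  "nat \<Rightarrow> (nat \<Rightarrow> nat) \<Rightarrow> (nat \<Rightarrow> nat) \<Rightarrow> (nat \<Rightarrow> nat \<Rightarrow> real) \<Rightarrow> nat \<Rightarrow> rmat" where
  "lmm_mat0 Ns Nt s c k =
     mat (Ns * Nt k) Ns (\<lambda>(p, q).
       let l = p div Ns + 1; n = theta Nt k + l - 1 in
       if p mod Ns = q \<and> s n = l then c n l else 0)"

definition start_state :: "nat \<Rightarrow> (nat \<Rightarrow> nat) \<Rightarrow> rvec \<Rightarrow> (nat \<Rightarrow> rvec) \<Rightarrow> nat \<Rightarrow> rvec" where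
  "start_state Ns Nt uinit u k =
     (if k = 0 then uinit else vec_block Ns (u (k - 1)) (Nt (k - 1)))"

definition trial_space :: "nat \<Rightarrow> nat \<Rightarrow> rvec \<Rightarrow> rmat \<Rightarrow> rvec set" where
  "trial_space Ns m v0 V =
     {stack Ns m (\<lambda>_. v0) + V *\<^sub>v z | z. z \<in> carrier_vec (dim_col V)}"

lemma window_residual_matrix_form:
  assumes Ns: "Ns \<ge> 1"
    and w: "w \<in> carrier_vec (Ns * Nt k)" and w0: "w0 \<in> carrier_vec Ns"
    and f0: "f w0 (t (theta Nt k - 1)) \<in> carrier_vec Ns"
    and st: "\<And>l. 1 \<le> l \<Longrightarrow> l \<le> Nt k \<Longrightarrow> s (theta Nt k + l - 1) \<le> l"
  shows "window_residual Ns f dt t Nt s \<alpha> \<beta> k w w0 =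
     lmm_mat Ns Nt s \<alpha> k *\<^sub>v w
     - dt \<cdot>\<^sub>v (lmm_mat Ns Nt s \<beta> k *\<^sub>v
               stack Ns (Nt k) (\<lambda>l. f (vec_block Ns w l) (t (theta Nt k + l - 1))))
     + lmm_mat0 Ns Nt s \<alpha> k *\<^sub>v w0
     - dt \<cdot>\<^sub>v (lmm_mat0 Ns Nt s \<beta> k *\<^sub>v f w0 (t (theta Nt k - 1)))"
proof -
  have key: "(\<Sum>j\<le>s n. c n j * g (n - j) $ (p mod Ns)) =
       (lmm_mat Ns Nt s c k *\<^sub>v stack Ns (Nt k) (\<lambda>l. g (theta Nt k + l - 1))) $ p
       + (lmm_mat0 Ns Nt s c k *\<^sub>v g (theta Nt k - 1)) $ p"
    if p: "p < Ns * Nt k" and n: "n = theta Nt k + (p div Ns + 1) - 1"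
      and g0: "g (theta Nt k - 1) \<in> carrier_vec Ns"
    for c :: "nat \<Rightarrow> nat \<Rightarrow> real" and g p n
  proof -
    define l where "l = p div Ns + 1"
    define i where "i = p mod Ns"
    have i: "i < Ns" using Ns by (simp add: i_def)
    have l: "1 \<le> l" "l \<le> Nt k"
      using p Ns by (auto simp: l_def less_mult_imp_div_less mult.commute Suc_le_eq)
    have sn: "s n \<le> l" using st[OF l] by (simp add: n l_def)
    have th: "theta Nt k \<ge> 1" by (simp add: theta_def)
    have nl: "n = theta Nt k + l - 1" by (simp add: n l_def)
    have "(lmm_mat Ns Nt s c k *\<^sub>v stack Ns (Nt k) (\<lambda>l. g (theta Nt k + l - 1))) $ p
      = (\<Sum>q<Ns * Nt k. (if i = q mod Ns \<and> q div Ns + 1 \<le> l \<and> l - (q div Ns + 1) \<le> s n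
            then c n (l - (q div Ns + 1)) else 0) * g (theta Nt k + (q div Ns + 1) - 1) $ (q mod Ns))"
      using p
      by (auto simp: lmm_mat_def stack_def scalar_prod_def l_def i_def n Let_def
               lessThan_atLeast0 intro!: sum.cong)
    also have "\<dots> = (\<Sum>q | q < Ns * Nt k \<and> i = q mod Ns \<and> q div Ns + 1 \<le> l \<and> l - (q div Ns + 1) \<le> s n.
            c n (l - (q div Ns + 1)) * g (theta Nt k + (q div Ns + 1) - 1) $ i)"
      by (rule sum.mono_neutral_cong_right) auto
    also have "\<dots> = (\<Sum>j | j \<le> s n \<and> j < l. c n j * g (n - j) $ i)"
    proof (rule sum.reindex_bij_witness[of _ "\<lambda>j. (l - j - 1) * Ns + i" "\<lambda>q. l - (q div Ns + 1)"])
      fix q assume q: "q \<in> {q. q < Ns * Nt k \<and> i = q mod Ns \<and> q div Ns + 1 \<le> l \<and> l - (q div Ns + 1) \<le> s n}"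
      then have "l - (l - (q div Ns + 1)) - 1 = q div Ns" by auto
      then show "(l - (l - (q div Ns + 1)) - 1) * Ns + i = q" using q by (simp add: div_mult_mod_eq)
      show "l - (q div Ns + 1) \<in> {j. j \<le> s n \<and> j < l}" using q by auto
      have "n - (l - (q div Ns + 1)) = theta Nt k + (q div Ns + 1) - 1" using q nl th by auto
      then show "c n (l - (q div Ns + 1)) * g (n - (l - (q div Ns + 1))) $ i =
         c n (l - (q div Ns + 1)) * g (theta Nt k + (q div Ns + 1) - 1) $ i" by simp
    next
      fix j assume j: "j \<in> {j. j \<le> s n \<and> j < l}"
      have d: "((l - j - 1) * Ns + i) div Ns = l - j - 1" using i by simp
      show "l - (((l - j - 1) * Ns + i) div Ns + 1) = j" using j unfolding d by auto
      have "(l - j - 1) * Ns + i < (l - j - 1) * Ns + Ns" using i by simp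
      also have "\<dots> = (l - j) * Ns" using j by (cases "l - j") auto
      also have "\<dots> \<le> Nt k * Ns" using l by (intro mult_right_mono) auto
      finally show "(l - j - 1) * Ns + i \<in> {q. q < Ns * Nt k \<and> i = q mod Ns \<and> q div Ns + 1 \<le> l \<and> l - (q div Ns + 1) \<le> s n}"
        using j i by (auto simp: d mult.commute)
    qed
    finally have 1: "(lmm_mat Ns Nt s c k *\<^sub>v stack Ns (Nt k) (\<lambda>l. g (theta Nt k + l - 1))) $ p
        = (\<Sum>j | j \<le> s n \<and> j < l. c n j * g (n - j) $ i)" .
    have "(lmm_mat0 Ns Nt s c k *\<^sub>v g (theta Nt k - 1)) $ p
       = (\<Sum>q<Ns. (if i = q \<and> s n = l then c n l else 0) * g (theta Nt k - 1) $ q)"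
      using p g0
      by (auto simp: lmm_mat0_def scalar_prod_def l_def i_def n Let_def
               lessThan_atLeast0 intro!: sum.cong)
    also have "\<dots> = (\<Sum>q<Ns. if q = i then (if s n = l then c n l * g (theta Nt k - 1) $ i else 0) else 0)"
      by (rule sum.cong) auto
    also have "\<dots> = (if s n = l then c n l * g (theta Nt k - 1) $ i else 0)"
      using i by simp
    also have "\<dots> = (\<Sum>j | j \<le> s n \<and> \<not> j < l. c n j * g (n - j) $ i)"
    proof (cases "s n = l")
      case True
      then have "{j. j \<le> s n \<and> \<not> j < l} = {l}" by auto
      moreover have "n - l = theta Nt k - 1" using nl th by simp
      ultimately show ?thesis using True by simp
    next
      case False
      then have "{j. j \<le> s n \<and> \<not> j < l} = {}" using sn by auto
      with False show ?thesis by (simp only: if_False sum.empty)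
    qed
    finally have 2: "(lmm_mat0 Ns Nt s c k *\<^sub>v g (theta Nt k - 1)) $ p
       = (\<Sum>j | j \<le> s n \<and> \<not> j < l. c n j * g (n - j) $ i)" .
    have "(\<Sum>j\<le>s n. c n j * g (n - j) $ i) =
        (\<Sum>j | j \<le> s n \<and> j < l. c n j * g (n - j) $ i)
        + (\<Sum>j | j \<le> s n \<and> \<not> j < l. c n j * g (n - j) $ i)"
      by (subst sum.union_disjoint[symmetric]) (auto intro!: sum.cong)
    then show ?thesis unfolding 1 2 by (simp add: i_def)
  qed
  let ?W = "window_state Ns Nt k w w0"
  let ?F = "\<lambda>m. f (?W m) (t m)"
  have th: "theta Nt k \<ge> 1" by (simp add: theta_def)
  have W0: "?W (theta Nt k - 1) = w0" by (simp add: window_state_def)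
  have Wl: "?W (theta Nt k + l - 1) = vec_block Ns w l" if "l \<ge> 1" for l
    using that th by (auto simp: window_state_def)
  have sw: "stack Ns (Nt k) (\<lambda>l. ?W (theta Nt k + l - 1)) = w"
  proof (rule eq_vecI)
    fix p assume "p < dim_vec w"
    then have p: "p < Ns * Nt k" using w by simp
    have "p mod Ns < Ns" using Ns by simp
    then show "stack Ns (Nt k) (\<lambda>l. ?W (theta Nt k + l - 1)) $ p = w $ p"
      using p Wl[of "p div Ns + 1"] by (simp add: stack_def vec_block_def div_mult_mod_eq)
  qed (use w in \<open>simp add: stack_def\<close>)
  have sf: "stack Ns (Nt k) (\<lambda>l. ?F (theta Nt k + l - 1)) =
      stack Ns (Nt k) (\<lambda>l. f (vec_block Ns w l) (t (theta Nt k + l - 1)))"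
  proof -
    have "?F (theta Nt k + (d + 1) - 1) = f (vec_block Ns w (d + 1)) (t (theta Nt k + (d + 1) - 1))" for d
      using Wl[of "d + 1"] by simp
    then show ?thesis unfolding stack_def by metis
  qed
  show ?thesis
  proof (rule eq_vecI, goal_cases)
    case (1 p)
    then have p: "p < Ns * Nt k" by (simp add: lmm_mat0_def)
    have m: "p mod Ns < Ns" using Ns by simp
    have A: "(\<Sum>j\<le>s n. \<alpha> n j * ?W (n - j) $ (p mod Ns)) =
       (lmm_mat Ns Nt s \<alpha> k *\<^sub>v w) $ p + (lmm_mat0 Ns Nt s \<alpha> k *\<^sub>v w0) $ p"
      if "n = theta Nt k + (p div Ns + 1) - 1" for n
      using key[OF p that, of ?W \<alpha>] w0 unfolding W0 sw by simp
    have B: "(\<Sum>j\<le>s n. \<beta> n j * ?F (n - j) $ (p mod Ns)) =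
       (lmm_mat Ns Nt s \<beta> k *\<^sub>v stack Ns (Nt k) (\<lambda>l. f (vec_block Ns w l) (t (theta Nt k + l - 1)))) $ p
       + (lmm_mat0 Ns Nt s \<beta> k *\<^sub>v f w0 (t (theta Nt k - 1))) $ p"
      if "n = theta Nt k + (p div Ns + 1) - 1" for n
      using key[OF p that, of ?F \<beta>] f0 unfolding W0 sf by simp
    have "window_residual Ns f dt t Nt s \<alpha> \<beta> k w w0 $ p =
      (let n = theta Nt k + (p div Ns + 1) - 1 in
        (\<Sum>j\<le>s n. \<alpha> n j * ?W (n - j) $ (p mod Ns))
        - dt * (\<Sum>j\<le>s n. \<beta> n j * ?F (n - j) $ (p mod Ns)))"
      using p m by (simp add: window_residual_def stack_def lmm_residual_def Let_def)
    also have "\<dots> = (lmm_mat Ns Nt s \<alpha> k *\<^sub>v w) $ p + (lmm_mat0 Ns Nt s \<alpha> k *\<^sub>v w0) $ p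
      - dt * ((lmm_mat Ns Nt s \<beta> k *\<^sub>v stack Ns (Nt k) (\<lambda>l. f (vec_block Ns w l) (t (theta Nt k + l - 1)))) $ p
       + (lmm_mat0 Ns Nt s \<beta> k *\<^sub>v f w0 (t (theta Nt k - 1))) $ p)"
      unfolding Let_def by (simp only: A[OF refl] B[OF refl])
    finally show ?case
      using p by (simp add: lmm_mat_def lmm_mat0_def algebra_simps del: index_mult_mat_vec)
  qed (simp add: window_residual_def stack_def lmm_mat0_def)
qed

end

theory Submission
  imports Defs "HOL-Analysis.Function_Topology" "HOL-Analysis.L2_Norm"
begin

text \<open>
  On window \<open>k\<close> the residual is bounded below by \<open>a\<^sup>k\<close> times a perturbation of the window states, and
  it changes by at most \<open>b\<^sup>k\<close> times a perturbation of the starting state. Comparing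
  \<open>r(ut; ut\<^sub>0)\<close> with \<open>r(u; ut\<^sub>0)\<close>, and using \<open>r(u; u\<^sub>0) = 0\<close>, gives
  \<open>a\<^sup>k |e\<^sup>k| \<le> |r(ut; ut\<^sub>0)| + b\<^sup>k |e\<^sub>0\<^sup>k|\<close>. By minimality of \<open>ut\<close> the residual on the right is at most
  \<open>|r(Pu; ut\<^sub>0)| \<le> |r(Pu; Pu\<^sub>0)| + b\<^sup>k |ut\<^sub>0 - Pu\<^sub>0|\<close>, and \<open>|ut\<^sub>0 - Pu\<^sub>0| \<le> |ut\<^sub>0 - u\<^sub>0|\<close> because
  \<open>ut\<^sub>0\<close> lies in the affine space projected onto. Since \<open>|e\<^sub>0\<^sup>k| \<le> |e\<^sup>k\<^sup>-\<^sup>1|\<close> and \<open>e\<^sub>0\<^sup>0 = 0\<close>, the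
  recursion \<open>a\<^sup>k |e\<^sup>k| \<le> |r(Pu; Pu\<^sub>0)| + 2 b\<^sup>k |e\<^sup>k\<^sup>-\<^sup>1|\<close> unrolls to the claim.
\<close>

section \<open>The Euclidean norm\<close>

text \<open>Gives access to the triangle inequality for \<open>L2_set\<close>.\<close>

lemma vnorm_eq_L2_set:
  "v \<in> carrier_vec n \<Longrightarrow> vnorm v = L2_set (\<lambda>i. v $ i) {0..<n}"
  unfolding vnorm_def L2_set_def scalar_prod_def by (simp add: power2_eq_square)

lemma scalar_prod_self_nonneg: "0 \<le> (v :: rvec) \<bullet> v"
  unfolding scalar_prod_def by (intro sum_nonneg) simp

lemma scalar_prod_self_eq_0_iff:
  assumes "(v :: rvec) \<in> carrier_vec n"
  shows "v \<bullet> v = 0 \<longleftrightarrow> v = 0\<^sub>v n"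
proof
  assume "v \<bullet> v = 0"
  then have "\<forall>i\<in>{0..<dim_vec v}. v $ i * v $ i = 0"
    unfolding scalar_prod_def by (subst (asm) sum_nonneg_eq_0_iff) auto
  then show "v = 0\<^sub>v n" using assms by (intro eq_vecI) auto
qed (use assms in auto)

lemma vnorm_nonneg: "0 \<le> vnorm v"
  by (simp add: vnorm_def scalar_prod_self_nonneg)

lemma vnorm_power2: "(vnorm v)\<^sup>2 = v \<bullet> v"
  by (simp add: vnorm_def scalar_prod_self_nonneg)

lemma vnorm_zero: "vnorm (0\<^sub>v n) = 0"
  by (simp add: vnorm_def)

lemma vnorm_smult: "vnorm (c \<cdot>\<^sub>v v) = \<bar>c\<bar> * vnorm v"
  by (simp add: vnorm_def real_sqrt_mult mult.assoc[symmetric])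

lemma vnorm_triangle:
  assumes "v \<in> carrier_vec n" "w \<in> carrier_vec n"
  shows "vnorm (v + w) \<le> vnorm v + vnorm w"
proof -
  have "vnorm (v + w) = L2_set (\<lambda>i. v $ i + w $ i) {0..<n}"
    using assms by (subst vnorm_eq_L2_set[of _ n]) (auto intro!: L2_set_cong)
  then show ?thesis
    using assms by (simp add: vnorm_eq_L2_set[of _ n] L2_set_triangle_ineq)
qed

lemma vnorm_triangle_minus:
  assumes "v \<in> carrier_vec n" "w \<in> carrier_vec n"
  shows "vnorm (v - w) \<le> vnorm v + vnorm w"
proof -
  have "v - w = v + (-1) \<cdot>\<^sub>v w" using assms by (intro eq_vecI) auto
  then show ?thesis using vnorm_triangle[of v n "(-1) \<cdot>\<^sub>v w"] assms by (simp add: vnorm_smult)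
qed

lemma vnorm_le_add_diff:
  assumes "v \<in> carrier_vec n" "w \<in> carrier_vec n"
  shows "vnorm v \<le> vnorm w + vnorm (v - w)"
proof -
  have "v = w + (v - w)" using assms by (intro eq_vecI) auto
  then show ?thesis using vnorm_triangle[of w n "v - w"] assms by simp
qed

lemma scalar_prod_diff_smult:
  assumes "(v :: rvec) \<in> carrier_vec n" "w \<in> carrier_vec n"
  shows "(v - c \<cdot>\<^sub>v w) \<bullet> (v - c \<cdot>\<^sub>v w) = v \<bullet> v - 2 * c * (v \<bullet> w) + c\<^sup>2 * (w \<bullet> w)"
  using assms comm_scalar_prod[of v n w]
  by (simp add: minus_scalar_prod_distrib[of _ n] scalar_prod_minus_distrib[of _ n]
      power2_eq_square algebra_simps)

section \<open>Singular values\<close>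

text \<open>First-order optimality: a quadratic in \<open>c\<close> that stays above its value at 0
  for all \<open>c > 0\<close> cannot have the negative slope \<open>-2 * D\<close> there. Both the
  eigenvector and the projection argument end with it.\<close>

lemma nonpos_if_le_quadratic:
  fixes D P :: real
  assumes "\<And>c. c > 0 \<Longrightarrow> 2 * c * D \<le> c\<^sup>2 * P"
  shows "D \<le> 0"
proof (rule ccontr)
  assume "\<not> D \<le> 0"
  then have D: "D > 0" by simp
  \<comment> \<open>This choice turns \<open>2 * D \<le> c * P\<close> into
    \<open>2 * D \<le> D\<close>; adding 1 keeps the denominator positive when
    \<open>P = 0\<close>.\<close>
  define c where "c = D / (\<bar>P\<bar> + 1)"
  have c: "c > 0" using D by (simp add: c_def add_nonneg_pos)
  have "c * (2 * D) \<le> c * (c * P)" using assms[OF c] by (simp add: power2_eq_square mult_ac)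
  then have "2 * D \<le> c * P" using c by simp
  also have "\<dots> \<le> c * (\<bar>P\<bar> + 1)" using c by (intro mult_left_mono) auto
  also have "\<dots> = D" by (simp add: c_def)
  finally show False using D by simp
qed

text \<open>
  The dimension \<open>n\<close> is a term, so compactness of the sphere is taken from the product topology on
  \<open>nat \<Rightarrow> real\<close>, where coordinates from \<open>n\<close> on are irrelevant.
\<close>

lemma quadratic_form_attains_min_on_sphere:
  fixes G :: rmat
  assumes G: "G \<in> carrier_mat n n" and n: "0 < n"
  obtains v where "v \<in> carrier_vec n" "v \<bullet> v = 1"
    and "\<And>x. x \<in> carrier_vec n \<Longrightarrow> x \<bullet> x = 1 \<Longrightarrow> v \<bullet> (G *\<^sub>v v) \<le> x \<bullet> (G *\<^sub>v x)"
proof -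
  \<comment> \<open>The condition \<open>N x = 1\<close> leaves the coordinates from
    \<open>n\<close> on free, so its solution set is not compact; it is cut down by the cube
    \<open>C\<close>, which is compact by Tychonoff.\<close>
  define C :: "(nat \<Rightarrow> real) set" where "C = PiE UNIV (\<lambda>i. {-1..1})"
  define N where "N = (\<lambda>x :: nat \<Rightarrow> real. \<Sum>i<n. x i * x i)"
  define q where "q = (\<lambda>x :: nat \<Rightarrow> real. \<Sum>i<n. x i * (\<Sum>j<n. G $$ (i, j) * x j))"
  have N: "vec n x \<bullet> vec n x = N x" for x
    by (simp add: N_def scalar_prod_def lessThan_atLeast0)
  have q: "vec n x \<bullet> (G *\<^sub>v vec n x) = q x" for x
    using G by (auto simp: q_def scalar_prod_def lessThan_atLeast0 intro!: sum.cong)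
  have coord: "continuous_on UNIV (\<lambda>x :: nat \<Rightarrow> real. x i)" for i
    by (rule continuous_on_product_coordinates)
  have contN: "continuous_on UNIV N" and contq: "continuous_on UNIV q"
    unfolding N_def q_def by (intro continuous_intros coord)+
  have "compact C"
    using compactin_PiE[of "\<lambda>_. euclidean" UNIV "\<lambda>_. {-1..1::real}"]
    by (simp add: C_def euclidean_product_topology)
  moreover have "closed {x. N x = 1}"
    using contN by (intro closed_Collect_eq) auto
  ultimately have comp: "compact (C \<inter> {x. N x = 1})" by (rule compact_Int_closed)
  have "(\<lambda>i. if i = 0 then 1 else 0) \<in> C \<inter> {x. N x = 1}"
  proof -
    have "(\<Sum>i<n. (if i = 0 then 1 else 0) * (if i = 0 then 1 else 0 :: real))
        = (\<Sum>i<n. if i = 0 then 1 else 0)"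
      by (rule sum.cong) auto
    then show ?thesis using n by (auto simp: C_def N_def)
  qed
  then obtain z where z: "z \<in> C \<inter> {x. N x = 1}"
    and min: "\<And>y. y \<in> C \<inter> {x. N x = 1} \<Longrightarrow> q z \<le> q y"
    using continuous_attains_inf[OF comp _ continuous_on_subset[OF contq]] by blast
  show thesis
  proof (rule that[of "vec n z"])
    show "vec n z \<bullet> vec n z = 1" using z by (simp add: N)
    fix x :: rvec assume x: "x \<in> carrier_vec n" "x \<bullet> x = 1"
    \<comment> \<open>Padding with zeros lands in the cube, since each squared entry is at most the
      sum \<open>N y = 1\<close>.\<close>
    define y where "y = (\<lambda>i. if i < n then x $ i else 0)"
    have xy: "vec n y = x" using x by (auto simp: y_def)
    have "N y = 1" using x N[of y] by (simp add: xy)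
    have "y i \<in> {-1..1}" for i
    proof (cases "i < n")
      case True
      have "y i * y i \<le> N y" unfolding N_def using True
        by (intro member_le_sum) auto
      then have "(y i)\<^sup>2 \<le> 1" using \<open>N y = 1\<close> by (simp add: power2_eq_square)
      then show ?thesis using abs_square_le_1[of "y i"] by auto
    qed (simp add: y_def)
    then have "y \<in> C \<inter> {x. N x = 1}" using \<open>N y = 1\<close> by (auto simp: C_def)
    from min[OF this] show "vec n z \<bullet> (G *\<^sub>v vec n z) \<le> x \<bullet> (G *\<^sub>v x)"
      by (simp add: q flip: xy)
  qed simp
qed

text \<open>The minimum \<open>e\<close> of the quadratic form on the unit sphere is the eigenvalue.
  Homogeneity extends the bound to all vectors, and a minimizer that is not an eigenvector could be
  improved by moving against its residual.\<close>

lemma symmetric_min_eigenvalue: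
  fixes G :: rmat
  assumes G: "G \<in> carrier_mat n n" and n: "0 < n" and sym: "transpose_mat G = G"
  obtains e where "eigenvalue G e"
    and "\<And>x. x \<in> carrier_vec n \<Longrightarrow> e * (x \<bullet> x) \<le> x \<bullet> (G *\<^sub>v x)"
proof -
  obtain v where v: "v \<in> carrier_vec n" and v1: "v \<bullet> v = 1"
    and min: "\<And>x. x \<in> carrier_vec n \<Longrightarrow> x \<bullet> x = 1 \<Longrightarrow> v \<bullet> (G *\<^sub>v v) \<le> x \<bullet> (G *\<^sub>v x)"
    using quadratic_form_attains_min_on_sphere[OF G n] by blast
  define e where "e = v \<bullet> (G *\<^sub>v v)"
  have Gc: "G *\<^sub>v x \<in> carrier_vec n" if "x \<in> carrier_vec n" for x
    using G that by simp
  have bound: "e * (x \<bullet> x) \<le> x \<bullet> (G *\<^sub>v x)" if x: "x \<in> carrier_vec n" for x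
  proof (cases "x \<bullet> x = 0")
    case True
    then have "x = 0\<^sub>v n" using scalar_prod_self_eq_0_iff[OF x] by simp
    then show ?thesis using Gc[of "0\<^sub>v n"] by simp
  next
    case False
    then have pos: "x \<bullet> x > 0" using scalar_prod_self_nonneg[of x] by simp
    define c where "c = 1 / vnorm x"
    have c2: "c * c = 1 / (x \<bullet> x)"
      by (simp add: c_def power_divide vnorm_power2 flip: power2_eq_square)
    have "(c \<cdot>\<^sub>v x) \<bullet> (c \<cdot>\<^sub>v x) = 1"
      using pos c2 by (simp add: mult.assoc[symmetric])
    from min[OF _ this] have "e \<le> (c \<cdot>\<^sub>v x) \<bullet> (G *\<^sub>v (c \<cdot>\<^sub>v x))"
      using x by (simp add: e_def)
    also have "\<dots> = c * c * (x \<bullet> (G *\<^sub>v x))"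
      using x G Gc[OF x] by (simp add: mult_mat_vec[OF G x] mult.assoc)
    finally show ?thesis using pos by (simp add: c2 field_simps)
  qed
  \<comment> \<open>For symmetric \<open>G\<close> this is half the gradient of
    \<open>x \<bullet> (G *\<^sub>v x) - e * (x \<bullet> x)\<close> at \<open>v\<close>, where that
    form attains its minimum 0.\<close>
  define h where "h = G *\<^sub>v v - e \<cdot>\<^sub>v v"
  have h: "h \<in> carrier_vec n" using v Gc by (simp add: h_def)
  have sym': "x \<bullet> (G *\<^sub>v y) = y \<bullet> (G *\<^sub>v x)"
    if "x \<in> carrier_vec n" "y \<in> carrier_vec n" for x y
    using transpose_vec_mult_scalar[OF G that(2,1)] comm_scalar_prod[OF that(2) Gc[OF that(1)]]
    by (simp add: sym)
  have hGv: "h \<bullet> (G *\<^sub>v v) = h \<bullet> h + e * (v \<bullet> h)"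
  proof -
    have "h \<bullet> h = h \<bullet> (G *\<^sub>v v) - e * (h \<bullet> v)"
      using h v Gc[OF v] by (subst (2) h_def) (simp add: scalar_prod_minus_distrib[of _ n])
    then show ?thesis using comm_scalar_prod[OF h v] by simp
  qed
  have "h \<bullet> h \<le> 0"
  proof (rule nonpos_if_le_quadratic[where P = "h \<bullet> (G *\<^sub>v h) - e * (h \<bullet> h)"])
    fix c :: real
    define y where "y = v - c \<cdot>\<^sub>v h"
    have y: "y \<in> carrier_vec n" using v h by (simp add: y_def)
    have Gy: "G *\<^sub>v y = G *\<^sub>v v - c \<cdot>\<^sub>v (G *\<^sub>v h)"
      using v h G by (simp add: y_def mult_minus_distrib_mat_vec[of _ n n] mult_mat_vec[of _ n n])
    have "y \<bullet> (G *\<^sub>v y) = v \<bullet> (G *\<^sub>v v) - c * (v \<bullet> (G *\<^sub>v h)) - c * (h \<bullet> (G *\<^sub>v v))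
          + c\<^sup>2 * (h \<bullet> (G *\<^sub>v h))"
      unfolding Gy unfolding y_def using v h Gc[OF v] Gc[OF h]
      by (simp add: minus_scalar_prod_distrib[of _ n] scalar_prod_minus_distrib[of _ n]
          power2_eq_square algebra_simps)
    also have "\<dots> = e - 2 * c * (h \<bullet> h + e * (v \<bullet> h)) + c\<^sup>2 * (h \<bullet> (G *\<^sub>v h))"
      using sym'[OF v h] hGv by (simp add: e_def)
    finally have yGy: "y \<bullet> (G *\<^sub>v y) = \<dots>" .
    have yy: "y \<bullet> y = 1 - 2 * c * (v \<bullet> h) + c\<^sup>2 * (h \<bullet> h)"
      unfolding y_def using scalar_prod_diff_smult[OF v h] v1 by simp
    \<comment> \<open>In the bound at \<open>v - c h\<close> the constants cancel because
      \<open>v\<close> is a unit vector attaining \<open>e\<close>, and so do the terms with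
      \<open>v \<bullet> h\<close>.\<close>
    show "2 * c * (h \<bullet> h) \<le> c\<^sup>2 * (h \<bullet> (G *\<^sub>v h) - e * (h \<bullet> h))"
      using bound[OF y] unfolding yGy yy by (simp add: algebra_simps)
  qed
  then have "h = 0\<^sub>v n"
    using scalar_prod_self_nonneg[of h] scalar_prod_self_eq_0_iff[OF h] by simp
  then have eq: "G *\<^sub>v v - e \<cdot>\<^sub>v v = 0\<^sub>v n" by (simp add: h_def)
  have "G *\<^sub>v v = e \<cdot>\<^sub>v v"
  proof (rule eq_vecI)
    fix i assume "i < dim_vec (e \<cdot>\<^sub>v v)"
    then have i: "i < n" using v by simp
    have "(G *\<^sub>v v - e \<cdot>\<^sub>v v) $ i = 0" using i by (simp add: eq)
    then show "(G *\<^sub>v v) $ i = (e \<cdot>\<^sub>v v) $ i" using i v G by simp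
  qed (use v G in simp)
  moreover have "v \<noteq> 0\<^sub>v n" using v1 by auto
  ultimately have "eigenvalue G e"
    using v G by (auto simp: eigenvalue_def eigenvector_def)
  then show thesis using bound that by blast
qed

text \<open>Negation swaps the extremes: \<open>G\<close> and \<open>- G\<close> share their
  eigenvectors, with eigenvalues of opposite sign.\<close>

lemma symmetric_max_eigenvalue:
  fixes G :: rmat
  assumes G: "G \<in> carrier_mat n n" and n: "0 < n" and sym: "transpose_mat G = G"
  obtains e where "eigenvalue G e"
    and "\<And>x. x \<in> carrier_vec n \<Longrightarrow> x \<bullet> (G *\<^sub>v x) \<le> e * (x \<bullet> x)"
proof -
  have mG: "- G \<in> carrier_mat n n" using G by simp
  have "transpose_mat (- G) = - transpose_mat G" by (intro eq_matI) auto
  then have msym: "transpose_mat (- G) = - G" by (simp add: sym)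
  obtain e where e: "eigenvalue (- G) e"
    and bound: "\<And>x. x \<in> carrier_vec n \<Longrightarrow> e * (x \<bullet> x) \<le> x \<bullet> (- G *\<^sub>v x)"
    using symmetric_min_eigenvalue[OF mG n msym] by blast
  from e obtain v where v: "v \<in> carrier_vec n" "v \<noteq> 0\<^sub>v n" "- G *\<^sub>v v = e \<cdot>\<^sub>v v"
    using G by (auto simp: eigenvalue_def eigenvector_def)
  have mGv: "- G *\<^sub>v x = - (G *\<^sub>v x)" if "x \<in> carrier_vec n" for x
    using that G by simp
  have "G *\<^sub>v v = - (- G *\<^sub>v v)" using mGv[OF v(1)] by simp
  also have "\<dots> = (- e) \<cdot>\<^sub>v v" unfolding v(3) by (intro eq_vecI) auto
  finally have "eigenvalue G (- e)"
    using v G by (auto simp: eigenvalue_def eigenvector_def)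
  moreover have "x \<bullet> (G *\<^sub>v x) \<le> - e * (x \<bullet> x)" if x: "x \<in> carrier_vec n" for x
    using bound[OF x] x G by (simp add: mGv[OF x])
  ultimately show thesis using that by blast
qed

section \<open>Gram matrices and norm bounds by singular values\<close>

lemma gram_scalar_prod:
  fixes M :: rmat
  assumes M: "M \<in> carrier_mat m n" and x: "x \<in> carrier_vec n"
  shows "x \<bullet> ((transpose_mat M * M) *\<^sub>v x) = (M *\<^sub>v x) \<bullet> (M *\<^sub>v x)"
proof -
  have Mx: "M *\<^sub>v x \<in> carrier_vec m" and tM: "transpose_mat M \<in> carrier_mat n m"
    using M x by auto
  have "x \<bullet> ((transpose_mat M * M) *\<^sub>v x) = (transpose_mat M *\<^sub>v (M *\<^sub>v x)) \<bullet> x"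
    using M x tM Mx comm_scalar_prod[of x n "transpose_mat M *\<^sub>v (M *\<^sub>v x)"] by simp
  also have "\<dots> = (M *\<^sub>v x) \<bullet> (M *\<^sub>v x)"
    by (rule transpose_vec_mult_scalar[OF M x Mx])
  finally show ?thesis .
qed

text \<open>Covers all window matrices: \<open>A\<close> and \<open>B\<close> are square, and
  \<open>A0\<close> and \<open>B0\<close> have at least as many rows as columns because a window has
  at least one step.\<close>

lemma singular_values_tall:
  assumes "M \<in> carrier_mat m n" "n \<le> m"
  shows "singular_values M = sqrt ` {e. eigenvalue (transpose_mat M * M) e}"
  using assms by (auto simp: singular_values_def)

text \<open>Makes \<open>Min\<close> and \<open>Max\<close> comparable with the members. The
  eigenvalues are roots of the characteristic polynomial, which is monic and hence nonzero.\<close>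

lemma finite_singular_values_tall:
  assumes M: "M \<in> carrier_mat m n" and "n \<le> m"
  shows "finite (singular_values M)"
proof -
  have G: "transpose_mat M * M \<in> carrier_mat n n" using M by simp
  have "char_poly (transpose_mat M * M) \<noteq> 0"
    using degree_monic_char_poly[OF G] by auto
  then have "finite {e. poly (char_poly (transpose_mat M * M)) e = 0}"
    by (rule poly_roots_finite)
  then show ?thesis
    by (simp add: singular_values_tall[OF assms] eigenvalue_root_char_poly[OF G])
qed

lemma gram_symmetric:
  fixes M :: rmat
  assumes "M \<in> carrier_mat m n"
  shows "transpose_mat (transpose_mat M * M) = transpose_mat M * M"
  using assms by (simp add: transpose_mult[of _ n m _ n])

text \<open>Some eigenvalue \<open>e\<close> of the Gram matrix bounds its quadratic form from
  below, and \<open>sigma_min M\<close> is at most \<open>sqrt e\<close>.\<close>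

lemma sigma_min_mult_vnorm_le:
  assumes M: "M \<in> carrier_mat m n" and "n \<le> m" "0 < n" and x: "x \<in> carrier_vec n"
  shows "sigma_min M * vnorm x \<le> vnorm (M *\<^sub>v x)"
proof -
  have G: "transpose_mat M * M \<in> carrier_mat n n" using M by simp
  obtain e where e: "eigenvalue (transpose_mat M * M) e"
    and bound: "e * (x \<bullet> x) \<le> x \<bullet> ((transpose_mat M * M) *\<^sub>v x)"
    using symmetric_min_eigenvalue[OF G \<open>0 < n\<close> gram_symmetric[OF M]] x by metis
  have "sigma_min M \<le> sqrt e"
    unfolding sigma_min_def
    using e finite_singular_values_tall[OF M \<open>n \<le> m\<close>]
    by (intro Min_le) (auto simp: singular_values_tall[OF M \<open>n \<le> m\<close>])
  then have "sigma_min M * vnorm x \<le> sqrt e * vnorm x"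
    by (intro mult_right_mono vnorm_nonneg)
  \<comment> \<open>\<open>sqrt\<close> is multiplicative and monotone on all reals, so the sign of
    \<open>e\<close> does not matter.\<close>
  also have "\<dots> = sqrt (e * (x \<bullet> x))" by (simp add: vnorm_def real_sqrt_mult)
  also have "\<dots> \<le> vnorm (M *\<^sub>v x)"
    using bound by (simp add: vnorm_def gram_scalar_prod[OF M x])
  finally show ?thesis .
qed

lemma vnorm_mult_mat_vec_le:
  assumes M: "M \<in> carrier_mat m n" and "n \<le> m" "0 < n" and x: "x \<in> carrier_vec n"
  shows "vnorm (M *\<^sub>v x) \<le> sigma_max M * vnorm x"
proof -
  have G: "transpose_mat M * M \<in> carrier_mat n n" using M by simp
  obtain e where e: "eigenvalue (transpose_mat M * M) e"
    and bound: "x \<bullet> ((transpose_mat M * M) *\<^sub>v x) \<le> e * (x \<bullet> x)"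
    using symmetric_max_eigenvalue[OF G \<open>0 < n\<close> gram_symmetric[OF M]] x by metis
  have "sqrt e \<le> sigma_max M"
    unfolding sigma_max_def
    using e finite_singular_values_tall[OF M \<open>n \<le> m\<close>]
    by (intro Max_ge) (auto simp: singular_values_tall[OF M \<open>n \<le> m\<close>])
  then have *: "sqrt e * vnorm x \<le> sigma_max M * vnorm x"
    by (intro mult_right_mono vnorm_nonneg)
  have "vnorm (M *\<^sub>v x) \<le> sqrt (e * (x \<bullet> x))"
    using bound by (simp add: vnorm_def gram_scalar_prod[OF M x])
  also have "\<dots> = sqrt e * vnorm x" by (simp add: vnorm_def real_sqrt_mult)
  finally show ?thesis using * by simp
qed

text \<open>The sign is read off from the norm bound at a unit vector.\<close>

lemma sigma_max_nonneg:
  assumes M: "M \<in> carrier_mat m n" and "n \<le> m" "0 < n"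
  shows "0 \<le> sigma_max M"
proof -
  have "vnorm (M *\<^sub>v unit_vec n 0) \<le> sigma_max M * vnorm (unit_vec n 0)"
    using assms by (intro vnorm_mult_mat_vec_le) auto
  moreover have "vnorm (unit_vec n 0) = 1" using \<open>0 < n\<close> by (simp add: vnorm_def)
  ultimately show ?thesis using vnorm_nonneg[of "M *\<^sub>v unit_vec n 0"] by simp
qed

section \<open>Projection onto affine subspaces\<close>

text \<open>
  The optimality of \<open>p\<close> along the line through \<open>p\<close> and \<open>x\<close> makes the angle at \<open>p\<close> between
  \<open>u\<close> and \<open>x\<close> non-acute.
\<close>

lemma affine_projection_nonexpansive:
  assumes T: "affine_subspace d T" and p: "is_arg_min (\<lambda>w. vnorm (u - w)) (\<lambda>w. w \<in> T) p"
    and x: "x \<in> T" and u: "u \<in> carrier_vec d"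
  shows "vnorm (x - p) \<le> vnorm (x - u)"
proof -
  have pT: "p \<in> T" and min: "\<And>w. w \<in> T \<Longrightarrow> vnorm (u - p) \<le> vnorm (u - w)"
    using p by (auto simp: is_arg_min_linorder)
  have pc: "p \<in> carrier_vec d" and xc: "x \<in> carrier_vec d"
    using T pT x by (auto simp: affine_subspace_def)
  have g: "u - p \<in> carrier_vec d" and h: "x - p \<in> carrier_vec d"
    using u pc xc by auto
  have D: "(u - p) \<bullet> (x - p) \<le> 0"
  proof (rule nonpos_if_le_quadratic)
    fix c :: real
    have "c \<cdot>\<^sub>v x + (1 - c) \<cdot>\<^sub>v p \<in> T"
      using T x pT by (simp add: affine_subspace_def)
    from min[OF this] have "vnorm (u - p) \<le> vnorm (u - (c \<cdot>\<^sub>v x + (1 - c) \<cdot>\<^sub>v p))" .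
    also have "u - (c \<cdot>\<^sub>v x + (1 - c) \<cdot>\<^sub>v p) = (u - p) - c \<cdot>\<^sub>v (x - p)"
      using u pc xc by (intro eq_vecI) (auto simp: algebra_simps)
    finally have "(u - p) \<bullet> (u - p) \<le> ((u - p) - c \<cdot>\<^sub>v (x - p)) \<bullet> ((u - p) - c \<cdot>\<^sub>v (x - p))"
      by (simp add: vnorm_def)
    then show "2 * c * ((u - p) \<bullet> (x - p)) \<le> c\<^sup>2 * ((x - p) \<bullet> (x - p))"
      by (simp add: scalar_prod_diff_smult[OF g h])
  qed
  \<comment> \<open>Law of cosines at \<open>p\<close>, with the factor 1 matching
    \<open>scalar_prod_diff_smult\<close>; the cross term only lengthens
    \<open>x - u\<close>.\<close>
  have "x - u = (x - p) - 1 \<cdot>\<^sub>v (u - p)"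
    using u pc xc by (intro eq_vecI) auto
  then have "(x - u) \<bullet> (x - u)
      = (x - p) \<bullet> (x - p) - 2 * ((u - p) \<bullet> (x - p)) + (u - p) \<bullet> (u - p)"
    using scalar_prod_diff_smult[OF h g, of 1] comm_scalar_prod[OF g h] by simp
  then show ?thesis
    using D scalar_prod_self_nonneg[of "u - p"] by (simp add: vnorm_def)
qed

section \<open>Stacked vectors\<close>

lemma vec_block_carrier [simp]: "vec_block d w l \<in> carrier_vec d"
  by (simp add: vec_block_def)

lemma stack_carrier [simp]: "stack d m g \<in> carrier_vec (d * m)"
  by (simp add: stack_def)

lemma block_entry_index:
  fixes l :: nat
  assumes "l < m" "i < d"
  shows "l * d + i < d * m"
proof -
  have "l * d + i < Suc l * d" using assms by simp
  also have "\<dots> \<le> m * d" using assms by (intro mult_le_mono1) simp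
  finally show ?thesis by (simp add: mult.commute)
qed

text \<open>Writing block numbers as \<open>Suc l\<close> resolves the truncated
  \<open>l - 1\<close> in \<open>vec_block\<close>.\<close>

lemma vec_block_stack:
  assumes "g (Suc l) \<in> carrier_vec d" "l < m"
  shows "vec_block d (stack d m g) (Suc l) = g (Suc l)"
proof (rule eq_vecI)
  fix i assume "i < dim_vec (g (Suc l))"
  then have i: "i < d" using assms by simp
  show "vec_block d (stack d m g) (Suc l) $ i = g (Suc l) $ i"
    using block_entry_index[OF assms(2) i] i by (simp add: vec_block_def stack_def)
qed (use assms in \<open>simp add: vec_block_def\<close>)

lemma vec_block_minus:
  assumes "v \<in> carrier_vec (d * m)" "w \<in> carrier_vec (d * m)" "l < m"
  shows "vec_block d (v - w) (Suc l) = vec_block d v (Suc l) - vec_block d w (Suc l)"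
  using assms block_entry_index[OF assms(3)] by (intro eq_vecI) (auto simp: vec_block_def)

text \<open>Pythagoras: the sum of squares is cut into consecutive runs of \<open>d\<close>
  entries.\<close>

lemma vnorm_power2_blocks:
  assumes "v \<in> carrier_vec (d * m)"
  shows "(vnorm v)\<^sup>2 = (\<Sum>l<m. (vnorm (vec_block d v (Suc l)))\<^sup>2)"
proof -
  have "(vnorm v)\<^sup>2 = (\<Sum>p<m * d. v $ p * v $ p)"
    using assms by (simp add: vnorm_power2 scalar_prod_def lessThan_atLeast0 mult.commute)
  also have "\<dots> = (\<Sum>l<m. \<Sum>p=l * d..<l * d + d. v $ p * v $ p)"
    by (rule sum.nat_group[symmetric])
  also have "\<dots> = (\<Sum>l<m. (vnorm (vec_block d v (Suc l)))\<^sup>2)"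
  proof (rule sum.cong)
    fix l
    show "(\<Sum>p=l * d..<l * d + d. v $ p * v $ p) = (vnorm (vec_block d v (Suc l)))\<^sup>2"
      using sum.shift_bounds_nat_ivl[of "\<lambda>p. v $ p * v $ p" 0 "l * d" d]
      by (simp add: vnorm_power2 scalar_prod_def vec_block_def add.commute)
  qed simp
  finally show ?thesis .
qed

text \<open>Applied to the last block, it passes the error of a window on to the next starting
  state.\<close>

lemma vnorm_vec_block_le:
  assumes "v \<in> carrier_vec (d * m)" "1 \<le> l" "l \<le> m"
  shows "vnorm (vec_block d v l) \<le> vnorm v"
proof -
  obtain l' where l': "l = Suc l'" "l' < m" using assms by (cases l) auto
  have "(vnorm (vec_block d v l))\<^sup>2 \<le> (vnorm v)\<^sup>2"
    unfolding vnorm_power2_blocks[OF assms(1)] l'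
    by (rule member_le_sum[where f = "\<lambda>l. (vnorm (vec_block d v (Suc l)))\<^sup>2"]) (use l' in auto)
  then show ?thesis by (rule power2_le_imp_le) (rule vnorm_nonneg)
qed

text \<open>Squared norms add over blocks, so a blockwise bound survives stacking with the same
  constant.\<close>

lemma vnorm_stack_diff_le:
  assumes g: "\<And>l. l < m \<Longrightarrow> g (Suc l) \<in> carrier_vec d"
    and g': "\<And>l. l < m \<Longrightarrow> g' (Suc l) \<in> carrier_vec d"
    and w: "w \<in> carrier_vec (d * m)" and K: "0 \<le> K"
    and le: "\<And>l. l < m \<Longrightarrow> vnorm (g (Suc l) - g' (Suc l)) \<le> K * vnorm (vec_block d w (Suc l))"
  shows "vnorm (stack d m g - stack d m g') \<le> K * vnorm w"
proof -
  have c: "stack d m g - stack d m g' \<in> carrier_vec (d * m)" by simp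
  have "(vnorm (stack d m g - stack d m g'))\<^sup>2 = (\<Sum>l<m. (vnorm (g (Suc l) - g' (Suc l)))\<^sup>2)"
    unfolding vnorm_power2_blocks[OF c]
    by (intro sum.cong) (auto simp: vec_block_minus[of _ d m] vec_block_stack g g')
  also have "\<dots> \<le> (\<Sum>l<m. (K * vnorm (vec_block d w (Suc l)))\<^sup>2)"
    by (intro sum_mono power_mono vnorm_nonneg) (auto intro: le)
  also have "\<dots> = (K * vnorm w)\<^sup>2"
    by (simp add: power_mult_distrib vnorm_power2_blocks[OF w] sum_distrib_left)
  finally show ?thesis
    by (rule power2_le_imp_le) (simp add: K vnorm_nonneg)
qed

section \<open>Stability of the windowed residual\<close>

lemma lmm_mat_carrier: "lmm_mat d Nt s c k \<in> carrier_mat (d * Nt k) (d * Nt k)"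
  by (simp add: lmm_mat_def)

lemma lmm_mat0_carrier: "lmm_mat0 d Nt s c k \<in> carrier_mat (d * Nt k) d"
  by (simp add: lmm_mat0_def)

lemma window_residual_carrier: "window_residual d f dt t Nt s \<alpha> \<beta> k w w0 \<in> carrier_vec (d * Nt k)"
  by (simp add: window_residual_def)

text \<open>Isolates one window. The conditions on \<open>f\<close> include \<open>l = 0\<close>,
  the time of the starting state, whereas stencils exist only from \<open>l = 1\<close> on.\<close>

locale lipschitz_window =
  fixes d :: nat and f :: "rvec \<Rightarrow> real \<Rightarrow> rvec" and dt :: real and t :: "nat \<Rightarrow> real"
    and Nt s :: "nat \<Rightarrow> nat" and \<alpha> \<beta> :: "nat \<Rightarrow> nat \<Rightarrow> real" and \<kappa> :: real and k :: nat
  assumes d: "d \<ge> 1" and Nt: "Nt k \<ge> 1" and dt: "dt > 0" and \<kappa>: "\<kappa> > 0"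
    and f: "\<And>w l. w \<in> carrier_vec d \<Longrightarrow> l \<le> Nt k \<Longrightarrow> f w (t (theta Nt k + l - 1)) \<in> carrier_vec d"
    and s: "\<And>l. 1 \<le> l \<Longrightarrow> l \<le> Nt k \<Longrightarrow> s (theta Nt k + l - 1) \<le> l"
    and lip: "\<And>w y l. w \<in> carrier_vec d \<Longrightarrow> y \<in> carrier_vec d \<Longrightarrow> l \<le> Nt k \<Longrightarrow>
       vnorm (f w (t (theta Nt k + l - 1)) - f y (t (theta Nt k + l - 1))) \<le> \<kappa> * vnorm (w - y)"
begin

abbreviation "r \<equiv> window_residual d f dt t Nt s \<alpha> \<beta> k"
abbreviation "A \<equiv> lmm_mat d Nt s \<alpha> k"
abbreviation "B \<equiv> lmm_mat d Nt s \<beta> k"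
abbreviation "A0 \<equiv> lmm_mat0 d Nt s \<alpha> k"
abbreviation "B0 \<equiv> lmm_mat0 d Nt s \<beta> k"
abbreviation "F w \<equiv> stack d (Nt k) (\<lambda>l. f (vec_block d w l) (t (theta Nt k + l - 1)))"

lemma residual_matrix_form:
  assumes "w \<in> carrier_vec (d * Nt k)" "w0 \<in> carrier_vec d"
  shows "r w w0 = A *\<^sub>v w - dt \<cdot>\<^sub>v (B *\<^sub>v F w) + A0 *\<^sub>v w0 - dt \<cdot>\<^sub>v (B0 *\<^sub>v f w0 (t (theta Nt k - 1)))"
  using window_residual_matrix_form[of d w Nt k w0 f t s dt \<alpha> \<beta>] assms d s f[of w0 0] by simp

lemma dims: "d * Nt k > 0" "d \<le> d * Nt k" "d > 0"
  using d Nt by auto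

lemma stacked_lipschitz:
  assumes w: "w \<in> carrier_vec (d * Nt k)" and y: "y \<in> carrier_vec (d * Nt k)"
  shows "vnorm (F w - F y) \<le> \<kappa> * vnorm (w - y)"
proof (rule vnorm_stack_diff_le)
  fix l assume l: "l < Nt k"
  show "vnorm (f (vec_block d w (Suc l)) (t (theta Nt k + Suc l - 1))
          - f (vec_block d y (Suc l)) (t (theta Nt k + Suc l - 1)))
        \<le> \<kappa> * vnorm (vec_block d (w - y) (Suc l))"
    unfolding vec_block_minus[OF w y l] using l by (intro lip) auto
qed (use w y \<kappa> f[OF vec_block_carrier, of "Suc _"] in auto)

text \<open>The terms of the common starting state cancel. What remains is \<open>A\<close> applied
  to \<open>w - y\<close>, reduced by at most the Lipschitz contribution through
  \<open>B\<close>.\<close>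

lemma residual_lower_bound:
  assumes w: "w \<in> carrier_vec (d * Nt k)" and y: "y \<in> carrier_vec (d * Nt k)"
    and w0: "w0 \<in> carrier_vec d"
  shows "(sigma_min A - sigma_max B * dt * \<kappa>) * vnorm (w - y) \<le> vnorm (r w w0 - r y w0)"
proof -
  let ?n = "d * Nt k"
  have wy: "w - y \<in> carrier_vec ?n" using w y by simp
  have Ac: "A \<in> carrier_mat ?n ?n" and Bc: "B \<in> carrier_mat ?n ?n"
    and A0c: "A0 \<in> carrier_mat ?n d" and B0c: "B0 \<in> carrier_mat ?n d"
    by (simp_all add: lmm_mat_carrier lmm_mat0_carrier)
  have Fc: "F w \<in> carrier_vec ?n" "F y \<in> carrier_vec ?n" "F w - F y \<in> carrier_vec ?n" by auto
  have c: "A *\<^sub>v (w - y) \<in> carrier_vec ?n" "dt \<cdot>\<^sub>v (B *\<^sub>v (F w - F y)) \<in> carrier_vec ?n"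
    using Ac Bc wy Fc by auto
  have "r w w0 - r y w0 = A *\<^sub>v (w - y) - dt \<cdot>\<^sub>v (B *\<^sub>v (F w - F y))"
    unfolding residual_matrix_form[OF w w0] residual_matrix_form[OF y w0]
      mult_minus_distrib_mat_vec[OF Ac w y] mult_minus_distrib_mat_vec[OF Bc Fc(1,2)]
    using Ac Bc A0c B0c
    by (intro eq_vecI) (simp_all add: right_diff_distrib del: index_mult_mat_vec)
  then have "vnorm (A *\<^sub>v (w - y)) \<le> dt * vnorm (B *\<^sub>v (F w - F y)) + vnorm (r w w0 - r y w0)"
    using vnorm_le_add_diff[OF c] dt by (simp add: vnorm_smult)
  moreover have "sigma_min A * vnorm (w - y) \<le> vnorm (A *\<^sub>v (w - y))"
    using sigma_min_mult_vnorm_le[OF Ac order.refl dims(1) wy] .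
  moreover have "dt * vnorm (B *\<^sub>v (F w - F y)) \<le> dt * (sigma_max B * (\<kappa> * vnorm (w - y)))"
  proof (intro mult_left_mono)
    have "vnorm (B *\<^sub>v (F w - F y)) \<le> sigma_max B * vnorm (F w - F y)"
      using vnorm_mult_mat_vec_le[OF Bc order.refl dims(1) Fc(3)] .
    also have "\<dots> \<le> sigma_max B * (\<kappa> * vnorm (w - y))"
      by (intro mult_left_mono stacked_lipschitz w y sigma_max_nonneg[OF Bc order.refl dims(1)])
    finally show "vnorm (B *\<^sub>v (F w - F y)) \<le> sigma_max B * (\<kappa> * vnorm (w - y))" .
  qed (use dt in simp)
  ultimately show ?thesis by (simp add: algebra_simps)
qed

text \<open>With common window states only the \<open>A0\<close> and \<open>B0\<close> terms remain,
  and the triangle inequality suffices.\<close>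

lemma residual_start_bound:
  assumes w: "w \<in> carrier_vec (d * Nt k)" and w0: "w0 \<in> carrier_vec d" and y0: "y0 \<in> carrier_vec d"
  shows "vnorm (r w w0 - r w y0) \<le> (sigma_max A0 + dt * \<kappa> * sigma_max B0) * vnorm (w0 - y0)"
proof -
  let ?n = "d * Nt k"
  let ?f = "\<lambda>x. f x (t (theta Nt k - 1))"
  have wy: "w0 - y0 \<in> carrier_vec d" using w0 y0 by simp
  have Ac: "A \<in> carrier_mat ?n ?n" and Bc: "B \<in> carrier_mat ?n ?n"
    and A0c: "A0 \<in> carrier_mat ?n d" and B0c: "B0 \<in> carrier_mat ?n d"
    by (simp_all add: lmm_mat_carrier lmm_mat0_carrier)
  have fc: "?f w0 \<in> carrier_vec d" "?f y0 \<in> carrier_vec d"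
    using f[OF w0, of 0] f[OF y0, of 0] by simp_all
  then have fd: "?f w0 - ?f y0 \<in> carrier_vec d" by simp
  have c: "A0 *\<^sub>v (w0 - y0) \<in> carrier_vec ?n" "dt \<cdot>\<^sub>v (B0 *\<^sub>v (?f w0 - ?f y0)) \<in> carrier_vec ?n"
    using A0c B0c wy fd by auto
  have "r w w0 - r w y0 = A0 *\<^sub>v (w0 - y0) - dt \<cdot>\<^sub>v (B0 *\<^sub>v (?f w0 - ?f y0))"
    unfolding residual_matrix_form[OF w w0] residual_matrix_form[OF w y0]
      mult_minus_distrib_mat_vec[OF A0c w0 y0] mult_minus_distrib_mat_vec[OF B0c fc]
    using Ac Bc A0c B0c
    by (intro eq_vecI) (simp_all add: right_diff_distrib del: index_mult_mat_vec)
  then have "vnorm (r w w0 - r w y0)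
      \<le> vnorm (A0 *\<^sub>v (w0 - y0)) + dt * vnorm (B0 *\<^sub>v (?f w0 - ?f y0))"
    using vnorm_triangle_minus[OF c] dt by (simp add: vnorm_smult)
  moreover have "vnorm (A0 *\<^sub>v (w0 - y0)) \<le> sigma_max A0 * vnorm (w0 - y0)"
    using vnorm_mult_mat_vec_le[OF A0c dims(2,3) wy] .
  moreover have "dt * vnorm (B0 *\<^sub>v (?f w0 - ?f y0)) \<le> dt * (sigma_max B0 * (\<kappa> * vnorm (w0 - y0)))"
  proof (intro mult_left_mono)
    have "vnorm (B0 *\<^sub>v (?f w0 - ?f y0)) \<le> sigma_max B0 * vnorm (?f w0 - ?f y0)"
      using vnorm_mult_mat_vec_le[OF B0c dims(2,3) fd] .
    also have "\<dots> \<le> sigma_max B0 * (\<kappa> * vnorm (w0 - y0))"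
      using lip[OF w0 y0, of 0]
      by (intro mult_left_mono sigma_max_nonneg[OF B0c dims(2,3)]) simp
    finally show "vnorm (B0 *\<^sub>v (?f w0 - ?f y0)) \<le> sigma_max B0 * (\<kappa> * vnorm (w0 - y0))" .
  qed (use dt in simp)
  ultimately show ?thesis by (simp add: algebra_simps)
qed

lemma start_coefficient_nonneg: "0 \<le> sigma_max A0 + dt * \<kappa> * sigma_max B0"
  using dt \<kappa> dims
  by (intro add_nonneg_nonneg mult_nonneg_nonneg sigma_max_nonneg[OF lmm_mat0_carrier]) auto

text \<open>\<open>w\<close> stands for the reduced solution, \<open>y\<close> for the full-order
  one and \<open>z\<close> for the projection. The factor 2 arises because the starting state is
  exchanged twice, in the residual of \<open>y\<close> and in that of \<open>z\<close>.\<close>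

lemma window_error_bound:
  assumes w: "w \<in> carrier_vec (d * Nt k)" and y: "y \<in> carrier_vec (d * Nt k)"
    and z: "z \<in> carrier_vec (d * Nt k)"
    and w0: "w0 \<in> carrier_vec d" and y0: "y0 \<in> carrier_vec d" and z0: "z0 \<in> carrier_vec d"
    and y_res: "r y y0 = 0\<^sub>v (d * Nt k)"
    and min: "vnorm (r w w0) \<le> vnorm (r z w0)"
    and proj: "vnorm (w0 - z0) \<le> vnorm (w0 - y0)"
  shows "(sigma_min A - sigma_max B * dt * \<kappa>) * vnorm (w - y)
    \<le> vnorm (r z z0) + 2 * (sigma_max A0 + dt * \<kappa> * sigma_max B0) * vnorm (w0 - y0)"
proof -
  let ?b = "sigma_max A0 + dt * \<kappa> * sigma_max B0"
  note rc = window_residual_carrier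
  have "(sigma_min A - sigma_max B * dt * \<kappa>) * vnorm (w - y) \<le> vnorm (r w w0 - r y w0)"
    by (rule residual_lower_bound[OF w y w0])
  also have "\<dots> \<le> vnorm (r w w0) + vnorm (r y w0)"
    by (rule vnorm_triangle_minus[OF rc rc])
  also have "vnorm (r w w0) \<le> vnorm (r z z0) + ?b * vnorm (w0 - y0)"
  proof -
    have "vnorm (r z w0) \<le> vnorm (r z z0) + vnorm (r z w0 - r z z0)"
      by (rule vnorm_le_add_diff[OF rc rc])
    also have "vnorm (r z w0 - r z z0) \<le> ?b * vnorm (w0 - z0)"
      by (rule residual_start_bound[OF z w0 z0])
    also have "\<dots> \<le> ?b * vnorm (w0 - y0)"
      by (rule mult_left_mono[OF proj start_coefficient_nonneg])
    finally show ?thesis using min by simp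
  qed
  also have "vnorm (r y w0) \<le> ?b * vnorm (w0 - y0)"
    using vnorm_le_add_diff[OF rc[of d f dt t Nt s \<alpha> \<beta> k y w0] rc[of d f dt t Nt s \<alpha> \<beta> k y y0]]
      residual_start_bound[OF y w0 y0] by (simp add: y_res vnorm_zero)
  finally show ?thesis by (simp add: algebra_simps)
qed

end

section \<open>Error accumulation over the windows\<close>

text \<open>Each step multiplies the accumulated coefficients by
  \<open>c (Suc k) / a (Suc k)\<close> and appends a new summand.\<close>

lemma linear_recursion_bound:
  fixes E R a c :: "nat \<Rightarrow> real"
  assumes a: "\<And>i. i \<le> k \<Longrightarrow> a i > 0" and c: "\<And>i. i \<le> k \<Longrightarrow> c i \<ge> 0"
    and E_0: "a 0 * E 0 \<le> R 0"
    and E_Suc: "\<And>i. Suc i \<le> k \<Longrightarrow> a (Suc i) * E (Suc i) \<le> R (Suc i) + c (Suc i) * E i"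
  shows "E k \<le> (\<Sum>i\<le>k. ((\<Prod>j<k - i. c (k - j)) / (\<Prod>j\<le>k - i. a (k - j))) * R i)"
  using assms
proof (induction k)
  case 0
  then show ?case by (simp add: field_simps)
next
  case (Suc k)
  let ?C = "\<lambda>k i. (\<Prod>j<k - i. c (k - j)) / (\<Prod>j\<le>k - i. a (k - j))"
  have IH: "E k \<le> (\<Sum>i\<le>k. ?C k i * R i)"
    using Suc.prems by (intro Suc.IH) auto
  have ak: "a (Suc k) > 0" using Suc.prems(1) by simp
  \<comment> \<open>The indices descend from \<open>Suc k\<close>: splitting off
    \<open>j = 0\<close> and shifting \<open>j\<close> leaves the products for
    \<open>k\<close>.\<close>
  have step: "?C (Suc k) i = c (Suc k) / a (Suc k) * ?C k i" if "i \<le> k" for i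
    by (simp only: Suc_diff_le[OF that] prod.lessThan_Suc_shift prod.atMost_Suc_shift
        diff_Suc_Suc diff_zero times_divide_times_eq)
  have "E (Suc k) \<le> (R (Suc k) + c (Suc k) * E k) / a (Suc k)"
    using Suc.prems(4)[of k] ak by (simp add: field_simps)
  also have "\<dots> = R (Suc k) / a (Suc k) + c (Suc k) / a (Suc k) * E k"
    by (simp add: add_divide_distrib)
  also have "\<dots> \<le> R (Suc k) / a (Suc k) + c (Suc k) / a (Suc k) * (\<Sum>i\<le>k. ?C k i * R i)"
    using ak Suc.prems(2)[of "Suc k"] IH by (intro add_left_mono mult_left_mono) auto
  also have "c (Suc k) / a (Suc k) * (\<Sum>i\<le>k. ?C k i * R i) = (\<Sum>i\<le>k. ?C (Suc k) i * R i)"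
    unfolding sum_distrib_left by (rule sum.cong) (simp_all only: step atMost_iff mult.assoc)
  \<comment> \<open>For \<open>i = Suc k\<close> the numerator is an empty product and the
    denominator the single factor \<open>a (Suc k)\<close>.\<close>
  also have "R (Suc k) / a (Suc k) + \<dots> = (\<Sum>i\<le>Suc k. ?C (Suc k) i * R i)"
    by simp
  finally show ?case .
qed

lemma trial_space_carrier:
  assumes "V \<in> carrier_mat (d * m) n" "w \<in> trial_space d m v0 V"
  shows "w \<in> carrier_vec (d * m)"
  using assms by (auto simp: trial_space_def)

text \<open>Places every time of a window, including the starting one at \<open>l = 0\<close>, where
  \<open>t\<close> is known to lie in \<open>{0..T}\<close>.\<close>

lemma window_time_index_le:
  assumes "k < Nw" "l \<le> Nt k"
  shows "theta Nt k + l - 1 \<le> (\<Sum>k<Nw. Nt k)"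
proof -
  have "theta Nt k + l - 1 \<le> (\<Sum>j<Suc k. Nt j)" using assms by (simp add: theta_def)
  also have "\<dots> \<le> (\<Sum>j<Nw. Nt j)" using assms by (intro sum_mono2) auto
  finally show ?thesis .
qed

theorem corollary6p3p1:
  fixes Ns Nw :: nat and Nt s :: "nat \<Rightarrow> nat"
    and f :: "rvec \<Rightarrow> real \<Rightarrow> rvec" and T dt \<kappa> :: real and t :: "nat \<Rightarrow> real"
    and \<alpha> \<beta> :: "nat \<Rightarrow> nat \<Rightarrow> real"
    and uinit :: rvec and u ut u0 ut0 Pu Pu0 :: "nat \<Rightarrow> rvec"
    and nb :: "nat \<Rightarrow> nat" and V :: "nat \<Rightarrow> rmat" and S \<T> :: "nat \<Rightarrow> rvec set"
    and r :: "nat \<Rightarrow> rvec \<Rightarrow> rvec \<Rightarrow> rvec" and A B A0 B0 :: "nat \<Rightarrow> rmat"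
    and a b :: "nat \<Rightarrow> real" and k :: nat
  assumes Ns: "Ns \<ge> 1"
    and f: "\<And>w \<tau>. w \<in> carrier_vec Ns \<Longrightarrow> \<tau> \<in> {0..T} \<Longrightarrow> f w \<tau> \<in> carrier_vec Ns"
    and uinit: "uinit \<in> carrier_vec Ns"
    and Nt: "\<And>k. k < Nw \<Longrightarrow> Nt k \<ge> 1"
    and dt: "dt > 0"
    and t_step: "\<And>n. n < (\<Sum>k<Nw. Nt k) \<Longrightarrow> t (Suc n) = t n + dt"
    and t_range: "\<And>n. n \<le> (\<Sum>k<Nw. Nt k) \<Longrightarrow> t n \<in> {0..T}"
    and \<alpha>_0: "\<And>n. 1 \<le> n \<Longrightarrow> n \<le> (\<Sum>k<Nw. Nt k) \<Longrightarrow> \<alpha> n 0 \<noteq> 0"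
    and \<alpha>_sum: "\<And>n. 1 \<le> n \<Longrightarrow> n \<le> (\<Sum>k<Nw. Nt k) \<Longrightarrow> (\<Sum>j\<le>s n. \<alpha> n j) = 0"
    and s_first: "\<And>k. k < Nw \<Longrightarrow> s (theta Nt k) = 1"
    and s_window: "\<And>k l. k < Nw \<Longrightarrow> 1 \<le> l \<Longrightarrow> l \<le> Nt k \<Longrightarrow> s (theta Nt k + l - 1) \<le> l"
    and r_def: "r = window_residual Ns f dt t Nt s \<alpha> \<beta>"
    and A_def: "A = lmm_mat Ns Nt s \<alpha>" and B_def: "B = lmm_mat Ns Nt s \<beta>"
    and A0_def: "A0 = lmm_mat0 Ns Nt s \<alpha>" and B0_def: "B0 = lmm_mat0 Ns Nt s \<beta>"
    \<comment> \<open>full-order solution\<close>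
    and u0_def: "u0 = start_state Ns Nt uinit u"
    and u: "\<And>k. k < Nw \<Longrightarrow> u k \<in> carrier_vec (Ns * Nt k)"
    and u_res: "\<And>k. k < Nw \<Longrightarrow> r k (u k) (u0 k) = 0\<^sub>v (Ns * Nt k)"
    \<comment> \<open>WST-LSPG solution\<close>
    and ut0_def: "ut0 = start_state Ns Nt uinit ut"
    and V: "\<And>k. k < Nw \<Longrightarrow> V k \<in> carrier_mat (Ns * Nt k) (nb k)"
    and S_def: "\<And>k. k < Nw \<Longrightarrow> S k = trial_space Ns (Nt k) (ut0 k) (V k)"
    and ut: "\<And>k. k < Nw \<Longrightarrow> is_arg_min (\<lambda>w. (vnorm (r k w (ut0 k)))\<^sup>2) (\<lambda>w. w \<in> S k) (ut k)"
    \<comment> \<open>trial subspaces for the starting states\<close>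
    and \<T>: "\<And>k. k < Nw \<Longrightarrow> affine_subspace Ns (\<T> k)"
    and ut0_\<T>: "\<And>k. k < Nw \<Longrightarrow> ut0 k \<in> \<T> k"
    and A1: "\<kappa> > 0"
      "\<And>w y \<tau>. w \<in> carrier_vec Ns \<Longrightarrow> y \<in> carrier_vec Ns \<Longrightarrow> \<tau> \<in> {0..T} \<Longrightarrow>
         vnorm (f w \<tau> - f y \<tau>) \<le> \<kappa> * vnorm (w - y)"
    and A2: "\<And>k. k < Nw \<Longrightarrow> sigma_min (A k) - sigma_max (B k) * dt * \<kappa> > 0"
    and a_def: "\<And>k. k < Nw \<Longrightarrow> a k = sigma_min (A k) - sigma_max (B k) * dt * \<kappa>"
    and b_def: "\<And>k. k < Nw \<Longrightarrow> b k = sigma_max (A0 k) + dt * \<kappa> * sigma_max (B0 k)"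
    and Pu: "\<And>i. i < Nw \<Longrightarrow> is_arg_min (\<lambda>w. vnorm (u i - w)) (\<lambda>w. w \<in> S i) (Pu i)"
    and Pu0: "\<And>i. i < Nw \<Longrightarrow> is_arg_min (\<lambda>w. vnorm (u0 i - w)) (\<lambda>w. w \<in> \<T> i) (Pu0 i)"
    and k: "k < Nw"
  shows "vnorm (ut k - u k) \<le>
    (\<Sum>i\<le>k. ((\<Prod>j<k - i. 2 * b (k - j)) / (\<Prod>j\<le>k - i. a (k - j))) * vnorm (r i (Pu i) (Pu0 i)))"
proof -
  have win: "lipschitz_window Ns f dt t Nt s \<kappa> i" if i: "i < Nw" for i
  proof
    show "f w (t (theta Nt i + l - 1)) \<in> carrier_vec Ns" if "w \<in> carrier_vec Ns" "l \<le> Nt i" for w l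
      using f[OF that(1) t_range[OF window_time_index_le[of i Nw _ Nt, OF i that(2)]]] .
    show "vnorm (f w (t (theta Nt i + l - 1)) - f y (t (theta Nt i + l - 1))) \<le> \<kappa> * vnorm (w - y)"
      if "w \<in> carrier_vec Ns" "y \<in> carrier_vec Ns" "l \<le> Nt i" for w y l
      using A1(2)[OF that(1,2) t_range[OF window_time_index_le[of i Nw _ Nt, OF i that(3)]]] .
  qed (use i Ns Nt dt A1 s_window in auto)
  \<comment> \<open>The square in the objective is removed using nonnegativity of the norm.\<close>
  have utS: "ut i \<in> S i" and ut_min: "\<And>w. w \<in> S i \<Longrightarrow> vnorm (r i (ut i) (ut0 i)) \<le> vnorm (r i w (ut0 i))"
    if "i < Nw" for i
    using ut[OF that] by (auto simp: is_arg_min_linorder vnorm_nonneg intro: power2_le_imp_le)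
  have PuS: "Pu i \<in> S i" if "i < Nw" for i
    using Pu[OF that] by (simp add: is_arg_min_def)
  have Sc: "w \<in> carrier_vec (Ns * Nt i)" if "i < Nw" "w \<in> S i" for i w
    using trial_space_carrier[OF V[OF that(1)]] that(2) by (simp add: S_def[OF that(1)])
  have u0c: "u0 i \<in> carrier_vec Ns" and ut0c: "ut0 i \<in> carrier_vec Ns" for i
    using uinit by (simp_all add: u0_def ut0_def start_state_def)
  have Pu0c: "Pu0 i \<in> carrier_vec Ns" if "i < Nw" for i
    using Pu0[OF that] \<T>[OF that] by (auto simp: is_arg_min_def affine_subspace_def)
  have b_nonneg: "0 \<le> b i" if "i < Nw" for i
    using lipschitz_window.start_coefficient_nonneg[OF win[OF that]] that
    by (simp add: b_def A0_def B0_def)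
  have error: "a i * vnorm (ut i - u i)
      \<le> vnorm (r i (Pu i) (Pu0 i)) + 2 * b i * vnorm (ut0 i - u0 i)" if i: "i < Nw" for i
    using lipschitz_window.window_error_bound[OF win[OF i] Sc[OF i utS[OF i]] u[OF i]
        Sc[OF i PuS[OF i]] ut0c u0c Pu0c[OF i] u_res[OF i, unfolded r_def]
        ut_min[OF i PuS[OF i], unfolded r_def]
        affine_projection_nonexpansive[OF \<T>[OF i] Pu0[OF i] ut0_\<T>[OF i] u0c]]
    by (simp add: a_def[OF i] b_def[OF i] A_def B_def A0_def B0_def r_def)
  show ?thesis
  proof (rule linear_recursion_bound)
    show "a i > 0" if "i \<le> k" for i
      using A2[of i] a_def[of i] that k by simp
    show "2 * b i \<ge> 0" if "i \<le> k" for i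
      using b_nonneg[of i] that k by simp
    \<comment> \<open>Both models start from \<open>uinit\<close>, so the first window inherits no
      error.\<close>
    have "ut0 0 - u0 0 = 0\<^sub>v Ns"
      using uinit by (simp add: u0_def ut0_def start_state_def)
    then show "a 0 * vnorm (ut 0 - u 0) \<le> vnorm (r 0 (Pu 0) (Pu0 0))"
      using error[of 0] k by (simp add: vnorm_zero)
    fix i assume "Suc i \<le> k"
    then have i: "i < Nw" "Suc i < Nw" using k by auto
    obtain l where l: "Nt i = Suc l" using Nt[OF i(1)] by (cases "Nt i") auto
    have utc: "ut i \<in> carrier_vec (Ns * Nt i)" using Sc[OF i(1) utS[OF i(1)]] .
    \<comment> \<open>Both starting states are last blocks of the preceding window, so their
      difference is the last block of its error.\<close>
    have "ut0 (Suc i) - u0 (Suc i) = vec_block Ns (ut i - u i) (Nt i)"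
      using vec_block_minus[OF utc u[OF i(1)], of l] l
      by (simp add: u0_def ut0_def start_state_def)
    then have "vnorm (ut0 (Suc i) - u0 (Suc i)) \<le> vnorm (ut i - u i)"
      using vnorm_vec_block_le[of "ut i - u i" Ns "Nt i" "Nt i"] utc u[OF i(1)] Nt[OF i(1)] by simp
    then have "2 * b (Suc i) * vnorm (ut0 (Suc i) - u0 (Suc i)) \<le> 2 * b (Suc i) * vnorm (ut i - u i)"
      using b_nonneg[OF i(2)] by (intro mult_left_mono) auto
    then show "a (Suc i) * vnorm (ut (Suc i) - u (Suc i))
        \<le> vnorm (r (Suc i) (Pu (Suc i)) (Pu0 (Suc i))) + 2 * b (Suc i) * vnorm (ut i - u i)"
      using error[OF i(2)] by simp
  qed
qed

end
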